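(* Let $X$ be a Tychonoff space. If $C_p(X)$ has the Pytkeev property and $X$ satisfies $\mathsf{U}_{fin}(\mathcal{O},\Omega)$, then $X$ satisfies $\mathsf{U}_{fin}(\mathcal{O},\Gamma)$ as well as $\mathsf{S}_1(\mathcal{O},\mathcal{O})$.
   Context: $C_p(X)$ is the set of all continuous real-valued functions on $X$ with the topology of pointwise convergence; $\mathbf{0}$ is the constant zero function. $C_p(X)$ has the Pytkeev property if for each $A\subseteq C_p(X)$ with $\mathbf{0}\in\overline{A}\setminus A$, there are infinite sets $A_1,A_2,\dots\subseteq A$ such that each neighborhood of $\mathbf{0}$ contains some $A_n$. A family $\mathcal{U}$ of subsets of $X$ is a cover of $X$ if $X=\bigcup\mathcal{U}$ but $X\notin\mathcal{U}$. A cover $\mathcal{U}$ of $X$ is an $\omega$-cover if for each finite $F\subseteq X$ there is $U\in\mathcal{U}$ with $F\subseteq U$. A cover $\mathcal{U}$ of $X$ is a $\gamma$-cover if it is infinite and for each $x\in X$, $x\in U$ for all but finitely many $U\in\mathcal{U}$. $\mathcal{O}$, $\Omega$, $\Gamma$ denote the collections of all open covers, open $\omega$-covers, and open $\gamma$-covers of $X$, respectively. For collections $\mathscr{A},\mathscr{B}$ of covers of $X$: $\mathsf{S}_1(\mathscr{A},\mathscr{B})$: for all $\mathcal{U}_1,\mathcal{U}_2,\dots\in\mathscr{A}$ there are $U_1\in\mathcal{U}_1,U_2\in\mathcal{U}_2,\dots$ such that $\{U_1,U_2,\dots\}\in\mathscr{B}$. $\mathsf{U}_{fin}(\mathscr{A},\mathscr{B})$: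 for all $\mathcal{U}_1,\mathcal{U}_2,\dots\in\mathscr{A}$ there are finite $\mathcal{F}_1\subseteq\mathcal{U}_1,\mathcal{F}_2\subseteq\mathcal{U}_2,\dots$ such that $\{\bigcup\mathcal{F}_1,\bigcup\mathcal{F}_2,\dots\}\in\mathscr{B}$.
   Formalization: U_fin is taken only over sequences of covers without finite subcovers (as literally defined, U_fin(O,Ω) fails for every Tychonoff X with at least two points), and X is assumed nonempty, since S_1(O,O) fails for the empty space. *)

theory Defs
  imports "HOL-Analysis.Analysis"
begin

definition tychonoff_space :: "'a topology \<Rightarrow> bool"
  where "tychonoff_space X \<longleftrightarrow> completely_regular_space X \<and> Hausdorff_space X"

(* The points of the product topology are functions extensional on topspace X
   (undefined elsewhere), so each continuous real function on X is represented
   by exactly one point of Cp X. *)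
definition Cp :: "'a topology \<Rightarrow> ('a \<Rightarrow> real) topology"
  where "Cp X = subtopology (product_topology (\<lambda>_. euclideanreal) (topspace X))
                  {f. continuous_map X euclideanreal f}"

definition Cp_zero :: "'a topology \<Rightarrow> 'a \<Rightarrow> real"
  where "Cp_zero X = (\<lambda>x\<in>topspace X. 0)"

lemma topspace_Cp:
  "topspace (Cp X) = {f \<in> extensional (topspace X). continuous_map X euclideanreal f}"
  by (auto simp: Cp_def PiE_def)

lemma Cp_zero_in_topspace: "Cp_zero X \<in> topspace (Cp X)"
proof -
  have "continuous_map X euclideanreal (\<lambda>x\<in>topspace X. 0)"
    by (rule continuous_map_eq [of _ _ "\<lambda>x. 0"]) auto
  then show ?thesis by (simp add: topspace_Cp Cp_zero_def)
qed

definition pytkeev_at :: "'b topology \<Rightarrow> 'b \<Rightarrow> bool"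
  where "pytkeev_at T z \<longleftrightarrow>
    (\<forall>A. A \<subseteq> topspace T \<and> z \<in> T closure_of A - A \<longrightarrow>
      (\<exists>B :: nat \<Rightarrow> 'b set. (\<forall>n. infinite (B n) \<and> B n \<subseteq> A) \<and>
         (\<forall>W. openin T W \<and> z \<in> W \<longrightarrow> (\<exists>n. B n \<subseteq> W))))"

(* C_p(X) is homogeneous, so the property is only required at the zero function. *)
definition Cp_pytkeev :: "'a topology \<Rightarrow> bool"
  where "Cp_pytkeev X \<longleftrightarrow> pytkeev_at (Cp X) (Cp_zero X)"

definition is_cover :: "'a topology \<Rightarrow> 'a set set \<Rightarrow> bool"
  where "is_cover X \<U> \<longleftrightarrow> topspace X = \<Union>\<U> \<and> topspace X \<notin> \<U>"

definition is_omega_cover :: "'a topology \<Rightarrow> 'a set set \<Rightarrow> bool"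
  where "is_omega_cover X \<U> \<longleftrightarrow>
    is_cover X \<U> \<and> (\<forall>F. finite F \<and> F \<subseteq> topspace X \<longrightarrow> (\<exists>U\<in>\<U>. F \<subseteq> U))"

definition is_gamma_cover :: "'a topology \<Rightarrow> 'a set set \<Rightarrow> bool"
  where "is_gamma_cover X \<U> \<longleftrightarrow>
    is_cover X \<U> \<and> infinite \<U> \<and> (\<forall>x\<in>topspace X. finite {U\<in>\<U>. x \<notin> U})"

definition open_covers :: "'a topology \<Rightarrow> 'a set set set"
  where "open_covers X = {\<U>. (\<forall>U\<in>\<U>. openin X U) \<and> is_cover X \<U>}"

definition open_omega_covers :: "'a topology \<Rightarrow> 'a set set set"
  where "open_omega_covers X = {\<U>. (\<forall>U\<in>\<U>. openin X U) \<and> is_omega_cover X \<U>}"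

definition open_gamma_covers :: "'a topology \<Rightarrow> 'a set set set"
  where "open_gamma_covers X = {\<U>. (\<forall>U\<in>\<U>. openin X U) \<and> is_gamma_cover X \<U>}"

definition S1 :: "'a set set set \<Rightarrow> 'a set set set \<Rightarrow> bool"
  where "S1 \<A> \<B> \<longleftrightarrow>
    (\<forall>\<U> :: nat \<Rightarrow> 'a set set. (\<forall>n. \<U> n \<in> \<A>) \<longrightarrow>
      (\<exists>U :: nat \<Rightarrow> 'a set. (\<forall>n. U n \<in> \<U> n) \<and> range U \<in> \<B>))"

definition has_finite_subcover :: "'a topology \<Rightarrow> 'a set set \<Rightarrow> bool"
  where "has_finite_subcover X \<U> \<longleftrightarrow> (\<exists>\<F>. finite \<F> \<and> \<F> \<subseteq> \<U> \<and> \<Union>\<F> = topspace X)"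

(* The usual convention for U_fin: only sequences of covers without finite subcovers
   are considered.  Members of B do not contain the whole space, so without this
   restriction Ufin X (open_covers X) B would already fail, for B either the open
   omega-covers or the open gamma-covers, on every T1 space with at least two points
   (take every term of the sequence to be {X - {a}, X - {b}}). *)
definition Ufin :: "'a topology \<Rightarrow> 'a set set set \<Rightarrow> 'a set set set \<Rightarrow> bool"
  where "Ufin X \<A> \<B> \<longleftrightarrow>
    (\<forall>\<U> :: nat \<Rightarrow> 'a set set.
      (\<forall>n. \<U> n \<in> \<A> \<and> \<not> has_finite_subcover X (\<U> n)) \<longrightarrow>
      (\<exists>\<F> :: nat \<Rightarrow> 'a set set. (\<forall>n. finite (\<F> n) \<and> \<F> n \<subseteq> \<U> n) \<and>
         range (\<lambda>n. \<Union>(\<F> n)) \<in> \<B>))"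

end

theory Submission
  imports Defs
begin

text \<open>
  A sequence of continuous functions that vanish on larger and larger finite sets has \<open>0\<close> in its
  closure, and the Pytkeev property then yields countably many infinite subsequences such that every
  point makes all functions of one of them small. Cozero separation turns the omega-covers provided
  by the hypothesis on \<open>U_fin\<close> into such functions.

  Hurewicz: let the \<open>n\<close>-th function come from a finite family refining all the covers with index at
  most \<open>n\<close>. A point good for an infinite set \<open>J\<close> of indices is then covered, at every stage \<open>m\<close>, by
  the finite subfamily of the \<open>m\<close>-th cover read off from the first element of \<open>J\<close> above \<open>m\<close>. Merging
  the first \<open>m\<close> of the countably many sets \<open>J\<close> at stage \<open>m\<close> covers each point at almost all stages.

  Rothberger: let \<open>\<F> i\<close> be finite families obtained from the Hurewicz property. Choosing one member of
  \<open>\<F> i\<close> for each \<open>i\<close> in a block of length \<open>n\<close> captures any \<open>n\<close> points once the block starts late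
  enough, so these choices again give functions with \<open>0\<close> in the closure. Each block admits only
  finitely many choices, so every infinite set given by the Pytkeev property meets arbitrarily late
  blocks. Picking one choice from each of these sets, in distinct blocks, gives the selection.
\<close>

section \<open>Covers and separating functions\<close>

text \<open>Unlike a member of \<open>open_covers\<close>, such a family may contain the whole
  space, so the refinements built below need no check against it.\<close>

definition covers :: "'a topology \<Rightarrow> 'a set set \<Rightarrow> bool"
  where "covers X \<U> \<longleftrightarrow> (\<forall>U\<in>\<U>. openin X U) \<and> \<Union>\<U> = topspace X"

definition separates :: "'a topology \<Rightarrow> 'a set \<Rightarrow> 'a set \<Rightarrow> ('a \<Rightarrow> real) \<Rightarrow> bool"
  where "separates X V U g \<longleftrightarrow>
    continuous_map X euclideanreal g \<and> (\<forall>x\<in>V. g x = 0) \<and> (\<forall>x\<in>topspace X - U. g x = 1)"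

lemma open_covers_iff: "\<U> \<in> open_covers X \<longleftrightarrow> covers X \<U> \<and> topspace X \<notin> \<U>"
  by (auto simp: open_covers_def is_cover_def covers_def)

text \<open>Complete regularity yields an \<open>f\<close> that is 0 at the point and 1 off
  \<open>U\<close>. Truncating \<open>2 * f - 1\<close> at 0 spreads the zero over the neighborhood
  where \<open>f < 1/2\<close> and keeps the value 1.\<close>

lemma completely_regular_separates:
  assumes "completely_regular_space X" "openin X U" "x \<in> U"
  obtains V g where "openin X V" "x \<in> V" "separates X V U g"
proof -
  have "closedin X (topspace X - U)" "x \<in> topspace X - (topspace X - U)"
    using assms openin_subset by auto
  then obtain f where f: "continuous_map X (top_of_set {0..1}) f" "f x = (0::real)"
      "f ` (topspace X - U) \<subseteq> {1}"
    using assms(1) unfolding completely_regular_space_def by blast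
  have cf: "continuous_map X euclideanreal f"
    using f(1) continuous_map_in_subtopology by blast
  let ?V = "{y \<in> topspace X. f y < 1/2}"
  have "openin X ?V"
    using openin_continuous_map_preimage[OF cf, of "{..<1/2}"] by simp
  moreover have "x \<in> ?V"
    using f assms openin_subset by fastforce
  moreover have "separates X ?V U (\<lambda>y. max 0 (2 * f y - 1))"
    using f(3) unfolding separates_def
    by (auto intro!: continuous_map_real_max continuous_map_diff continuous_map_real_mult cf)
  ultimately show thesis by (rule that)
qed

text \<open>A finite product vanishes as soon as one factor does, and is 1 where all factors are 1.
  An empty product is the constant 1, which suits the empty unions.\<close>

lemma separates_prod:
  assumes "finite I" "\<And>i. i \<in> I \<Longrightarrow> separates X (V i) (U i) (g i)"
  shows "separates X (\<Union>i\<in>I. V i) (\<Union>i\<in>I. U i) (\<lambda>x. \<Prod>i\<in>I. g i x)"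
  using assms unfolding separates_def
  by (auto intro!: continuous_map_prod prod.neutral simp: prod_zero_iff)

lemma separates_in:
  assumes "separates X V U g" "x \<in> topspace X" "\<bar>g x\<bar> < 1"
  shows "x \<in> U"
  using assms by (force simp: separates_def)

section \<open>The Pytkeev property for indexed families\<close>

text \<open>The property is applied to the set of restrictions of the \<open>h i\<close>:
  \<open>nz\<close> keeps the zero function out of this set and \<open>small\<close> puts it into
  the closure. Of the conclusion, only the neighborhoods given by a bound at one point are
  used.\<close>

lemma pytkeev_family:
  fixes h :: "'i \<Rightarrow> 'a \<Rightarrow> real"
  assumes pyt: "Cp_pytkeev X"
    and cont: "\<And>i. i \<in> I \<Longrightarrow> continuous_map X euclideanreal (h i)"
    and nz: "\<And>i. i \<in> I \<Longrightarrow> \<exists>x\<in>topspace X. h i x \<noteq> 0"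
    and small: "\<And>F. finite F \<Longrightarrow> F \<subseteq> topspace X \<Longrightarrow> \<exists>i\<in>I. \<forall>x\<in>F. h i x = 0"
  obtains J :: "nat \<Rightarrow> 'i set" where "\<And>k. infinite (J k)" "\<And>k. J k \<subseteq> I"
    "\<And>x. x \<in> topspace X \<Longrightarrow> \<exists>k. \<forall>i\<in>J k. \<bar>h i x\<bar> < 1"
proof -
  let ?r = "\<lambda>i. restrict (h i) (topspace X)"
  let ?A = "?r ` I"
  have A: "?A \<subseteq> topspace (Cp X)"
    unfolding topspace_Cp using cont by (auto intro: continuous_map_eq)
  have "Cp_zero X \<notin> ?A"
  proof
    assume "Cp_zero X \<in> ?A"
    then obtain i where i: "i \<in> I" "Cp_zero X = ?r i" by blast
    then obtain x where "x \<in> topspace X" "h i x \<noteq> 0" using nz by blast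
    then show False using fun_cong[OF i(2), of x] by (simp add: Cp_zero_def)
  qed
  moreover have "Cp_zero X \<in> Cp X closure_of ?A"
    unfolding in_closure_of
  proof (intro conjI allI impI)
    show "Cp_zero X \<in> topspace (Cp X)" by (rule Cp_zero_in_topspace)
    fix W assume W: "Cp_zero X \<in> W \<and> openin (Cp X) W"
    then obtain T where T: "openin (product_topology (\<lambda>_. euclideanreal) (topspace X)) T"
      "W = T \<inter> {f. continuous_map X euclideanreal f}"
      unfolding Cp_def openin_subtopology by blast
    \<comment> \<open>A basic neighborhood restricts only finitely many coordinates, and some
      \<open>h i\<close> vanishes at all of them.\<close>
    then obtain N where N: "finite {x \<in> topspace X. N x \<noteq> topspace euclideanreal}"
        "Cp_zero X \<in> Pi\<^sub>E (topspace X) N" "Pi\<^sub>E (topspace X) N \<subseteq> T"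
      using W unfolding openin_product_topology_alt by blast
    then obtain i where i: "i \<in> I" "\<forall>x\<in>{x \<in> topspace X. N x \<noteq> topspace euclideanreal}. h i x = 0"
      using small[OF N(1)] by blast
    have "?r i \<in> Pi\<^sub>E (topspace X) N"
    proof (rule PiE_I)
      fix x assume x: "x \<in> topspace X"
      have "Cp_zero X x \<in> N x" using N(2) x by (rule PiE_mem)
      then show "?r i x \<in> N x" using i(2) x by (cases "N x = UNIV") (auto simp: Cp_zero_def)
    qed simp
    moreover have "continuous_map X euclideanreal (?r i)"
      using A i(1) unfolding topspace_Cp by blast
    ultimately show "\<exists>y. y \<in> ?A \<and> y \<in> W" using i(1) N(3) T(2) by blast
  qed
  ultimately have "Cp_zero X \<in> Cp X closure_of ?A - ?A" by blast
  then obtain B :: "nat \<Rightarrow> ('a \<Rightarrow> real) set" where B: "\<And>n. infinite (B n)" "\<And>n. B n \<subseteq> ?A"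
      "\<And>W. openin (Cp X) W \<Longrightarrow> Cp_zero X \<in> W \<Longrightarrow> \<exists>n. B n \<subseteq> W"
    using pyt A unfolding Cp_pytkeev_def pytkeev_at_def by metis
  show thesis
  proof (rule that)
    \<comment> \<open>Passing back to indices preserves infinity even if \<open>h\<close> is not
      injective, because finitely many indices give finitely many functions.\<close>
    let ?J = "\<lambda>k. {i \<in> I. ?r i \<in> B k}"
    show "infinite (?J k)" for k
    proof
      assume "finite (?J k)"
      then have "finite (?r ` ?J k)" by simp
      moreover have "B k \<subseteq> ?r ` ?J k" using B(2)[of k] by blast
      ultimately show False using B(1) finite_subset by blast
    qed
    show "?J k \<subseteq> I" for k by blast
    fix x assume x: "x \<in> topspace X"
    have "continuous_map (Cp X) euclideanreal (\<lambda>f. f x)"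
      unfolding Cp_def using x
      by (intro continuous_map_from_subtopology continuous_map_product_projection)
    from openin_continuous_map_preimage[OF this, of "{-1<..<1}"]
    have "openin (Cp X) {f \<in> topspace (Cp X). f x \<in> {-1<..<1}}" by simp
    from B(3)[OF this] obtain k where "B k \<subseteq> {f \<in> topspace (Cp X). f x \<in> {-1<..<1}}"
      using Cp_zero_in_topspace[of X] x by (auto simp: Cp_zero_def)
    then have "\<forall>i\<in>?J k. \<bar>h i x\<bar> < 1" using x by fastforce
    then show "\<exists>k. \<forall>i\<in>?J k. \<bar>h i x\<bar> < 1" by blast
  qed
qed

section \<open>The Hurewicz property\<close>

text \<open>Covers with finite subcovers, which \<open>Ufin\<close> ignores, are allowed here.\<close>

lemma Ufin_omega_covers:
  fixes \<U> :: "nat \<Rightarrow> 'a set set"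
  assumes ufin: "Ufin X (open_covers X) (open_omega_covers X)"
    and cov: "\<And>n. covers X (\<U> n)"
  obtains \<F> :: "nat \<Rightarrow> 'a set set" where "\<And>n. finite (\<F> n)" "\<And>n. \<F> n \<subseteq> \<U> n"
    "\<And>F. finite F \<Longrightarrow> F \<subseteq> topspace X \<Longrightarrow> \<exists>n. F \<subseteq> \<Union>(\<F> n)"
proof (cases "\<exists>n. has_finite_subcover X (\<U> n)")
  case True
  then obtain n where "has_finite_subcover X (\<U> n)" by (elim exE)
  then obtain \<G> where G: "finite \<G>" "\<G> \<subseteq> \<U> n" "\<Union>\<G> = topspace X"
    unfolding has_finite_subcover_def by (elim exE conjE)
  show thesis
  proof (rule that)
    \<comment> \<open>One stage that covers the whole space serves every finite set, so all other
      stages may be empty.\<close>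
    let ?F = "\<lambda>m. if m = n then \<G> else {}"
    show "finite (?F m)" "?F m \<subseteq> \<U> m" for m using G by auto
    show "\<exists>m. F \<subseteq> \<Union>(?F m)" if "F \<subseteq> topspace X" for F
      using that G(3) by (intro exI[of _ n]) simp
  qed
next
  case False
  have "topspace X \<notin> \<U> n" for n
  proof
    assume "topspace X \<in> \<U> n"
    then have "has_finite_subcover X (\<U> n)"
      unfolding has_finite_subcover_def by (intro exI[of _ "{topspace X}"]) auto
    then show False using False by blast
  qed
  then have "\<forall>n. \<U> n \<in> open_covers X \<and> \<not> has_finite_subcover X (\<U> n)"
    using cov False by (simp add: open_covers_iff)
  then obtain \<F> where "\<forall>n. finite (\<F> n) \<and> \<F> n \<subseteq> \<U> n"
      "range (\<lambda>n. \<Union>(\<F> n)) \<in> open_omega_covers X"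
    using ufin unfolding Ufin_def by metis
  then show thesis
    by (intro that[of \<F>]) (auto simp: open_omega_covers_def is_omega_cover_def)
qed

text \<open>Excluding finite subcovers ensures that no \<open>h n\<close> is identically zero, as
  \<open>pytkeev_family\<close> demands.\<close>

lemma hurewicz_selection_no_subcover:
  fixes \<U> :: "nat \<Rightarrow> 'a set set"
  assumes cr: "completely_regular_space X" and pyt: "Cp_pytkeev X"
    and ufin: "Ufin X (open_covers X) (open_omega_covers X)"
    and cov: "\<And>n. covers X (\<U> n)" and nofin: "\<And>n. \<not> has_finite_subcover X (\<U> n)"
  obtains \<H> :: "nat \<Rightarrow> 'a set set" where "\<And>n. finite (\<H> n)" "\<And>n. \<H> n \<subseteq> \<U> n"
    "\<And>x. x \<in> topspace X \<Longrightarrow> \<exists>m. \<forall>n\<ge>m. x \<in> \<Union>(\<H> n)"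
proof -
  \<comment> \<open>Refining all covers up to index \<open>n\<close> allows a family chosen at stage
    \<open>n\<close> to be used at any earlier stage.\<close>
  define P where "P n V W g \<longleftrightarrow> (\<forall>j\<le>n. \<exists>U\<in>\<U> j. W \<subseteq> U) \<and> separates X V W g" for n V W g
  define \<V> where "\<V> n = {V. openin X V \<and> V \<subseteq> topspace X \<and> (\<exists>W g. P n V W g)}" for n
  have "covers X (\<V> n)" for n
    unfolding covers_def
  proof (intro conjI equalityI subsetI ballI)
    show "openin X U" if "U \<in> \<V> n" for U using that by (simp add: \<V>_def)
    show "x \<in> topspace X" if "x \<in> \<Union>(\<V> n)" for x using that by (auto simp: \<V>_def)
    fix x assume x: "x \<in> topspace X"
    have "\<exists>U. U \<in> \<U> j \<and> x \<in> U" for j using cov[of j] x by (auto simp: covers_def)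
    then obtain u where u: "\<And>j. u j \<in> \<U> j" "\<And>j. x \<in> u j" by metis
    have "openin X (\<Inter>j\<le>n. u j)"
      using u cov by (intro openin_INT2) (auto simp: covers_def)
    then obtain V g where V: "openin X V" "x \<in> V" "separates X V (\<Inter>j\<le>n. u j) g"
      using completely_regular_separates[OF cr, of "\<Inter>j\<le>n. u j" x] u by blast
    have "P n V (\<Inter>j\<le>n. u j) g"
      using V u unfolding P_def by blast
    then show "x \<in> \<Union>(\<V> n)" using V openin_subset[OF V(1)] unfolding \<V>_def by blast
  qed
  from Ufin_omega_covers[where \<U> = \<V>, OF ufin this] obtain \<F> where
    F: "\<And>n. finite (\<F> n)" "\<And>n. \<F> n \<subseteq> \<V> n"
      "\<And>F. finite F \<Longrightarrow> F \<subseteq> topspace X \<Longrightarrow> \<exists>n. F \<subseteq> \<Union>(\<F> n)" by metis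
  define W where "W n V = (SOME W. \<exists>g. P n V W g)" for n V
  define g where "g n V = (SOME g. P n V (W n V) g)" for n V
  have Wg: "P n V (W n V) (g n V)" if "V \<in> \<F> n" for n V
  proof -
    have "\<exists>W g. P n V W g" using F(2)[of n] that unfolding \<V>_def by blast
    then have "\<exists>g. P n V (W n V) g" unfolding W_def by (rule someI_ex)
    then show ?thesis unfolding g_def by (rule someI_ex)
  qed
  \<comment> \<open>\<open>R j n\<close> carries the stage \<open>n\<close> family back to members
    of the cover with index \<open>j\<close>, for \<open>j \<le> n\<close>.\<close>
  define R where "R j n V = (SOME U. U \<in> \<U> j \<and> W n V \<subseteq> U)" for j n V
  have "R j n V \<in> \<U> j \<and> W n V \<subseteq> R j n V" if "V \<in> \<F> n" "j \<le> n" for j n V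
  proof -
    have "\<exists>U. U \<in> \<U> j \<and> W n V \<subseteq> U" using Wg[OF that(1)] that(2) unfolding P_def by blast
    then show ?thesis unfolding R_def by (rule someI_ex)
  qed
  then have R: "\<And>j n V. V \<in> \<F> n \<Longrightarrow> j \<le> n \<Longrightarrow> R j n V \<in> \<U> j"
      "\<And>j n V. V \<in> \<F> n \<Longrightarrow> j \<le> n \<Longrightarrow> W n V \<subseteq> R j n V" by blast+
  define h where "h n x = (\<Prod>V\<in>\<F> n. g n V x)" for n x
  have sep: "separates X (\<Union>(\<F> n)) (\<Union>V\<in>\<F> n. W n V) (h n)" for n
    using separates_prod[OF F(1)[of n], of X "\<lambda>V. V" "W n" "g n"] Wg
    unfolding h_def P_def by simp
  \<comment> \<open>If \<open>h n\<close> were zero everywhere, the sets \<open>W n V\<close> would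
    cover the space, and so would the finitely many \<open>R n n V\<close>.\<close>
  have nz: "\<exists>x\<in>topspace X. h n x \<noteq> 0" for n
  proof (rule ccontr)
    assume "\<not> ?thesis"
    then have "topspace X \<subseteq> (\<Union>V\<in>\<F> n. W n V)" using separates_in[OF sep] by fastforce
    also have "\<dots> \<subseteq> \<Union>(R n n ` \<F> n)" using R(2) by blast
    finally have "topspace X \<subseteq> \<Union>(R n n ` \<F> n)" .
    moreover have "R n n ` \<F> n \<subseteq> \<U> n" using R(1) by blast
    moreover have "\<Union>(\<U> n) = topspace X" using cov by (simp add: covers_def)
    ultimately have "has_finite_subcover X (\<U> n)"
      unfolding has_finite_subcover_def using F(1)[of n]
      by (intro exI[of _ "R n n ` \<F> n"]) blast
    then show False using nofin by blast
  qed
  have small: "\<exists>n\<in>UNIV. \<forall>x\<in>E. h n x = 0" if "finite E" "E \<subseteq> topspace X" for E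
    using F(3)[OF that] sep unfolding separates_def by blast
  have cont: "continuous_map X euclideanreal (h n)" for n
    using sep unfolding separates_def by blast
  from pytkeev_family[where h = h and I = UNIV, OF pyt cont nz small]
  obtain J :: "nat \<Rightarrow> nat set" where J: "\<And>k. infinite (J k)"
    "\<And>x. x \<in> topspace X \<Longrightarrow> \<exists>k. \<forall>n\<in>J k. \<bar>h n x\<bar> < 1" by metis
  have "\<exists>n. n \<in> J k \<and> m \<le> n" for k m
    using J(1)[of k] infinite_nat_iff_unbounded_le by blast
  then obtain nxt where nxt: "\<And>k m. nxt k m \<in> J k" "\<And>k m. m \<le> nxt k m" by metis
  show thesis
  proof (rule that)
    \<comment> \<open>Which \<open>k\<close> suits a point is unknown in advance. Merging all
      \<open>k \<le> m\<close> at stage \<open>m\<close> includes the right one from stage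
      \<open>k\<close> on, and \<open>nxt k m \<ge> m\<close> permits the transfer by
      \<open>R m\<close>.\<close>
    let ?H = "\<lambda>m. \<Union>k\<le>m. R m (nxt k m) ` \<F> (nxt k m)"
    show "finite (?H m)" for m using F(1) by blast
    show "?H m \<subseteq> \<U> m" for m using R(1) nxt(2) by blast
    fix x assume x: "x \<in> topspace X"
    then obtain k where k: "\<forall>n\<in>J k. \<bar>h n x\<bar> < 1" using J(2) by blast
    have "x \<in> \<Union>(?H m)" if "k \<le> m" for m
    proof -
      have "x \<in> (\<Union>V\<in>\<F> (nxt k m). W (nxt k m) V)"
        using separates_in[OF sep x] k nxt(1) by blast
      then show ?thesis using R(2) nxt(2) that by blast
    qed
    then show "\<exists>l. \<forall>m\<ge>l. x \<in> \<Union>(?H m)" by blast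
  qed
qed

text \<open>Stages with a finite subcover simply use it. To apply the previous lemma, they are
  replaced by one fixed cover \<open>\<U> p\<close> without a finite subcover, if there is
  one.\<close>

lemma hurewicz_selection:
  fixes \<U> :: "nat \<Rightarrow> 'a set set"
  assumes cr: "completely_regular_space X" and pyt: "Cp_pytkeev X"
    and ufin: "Ufin X (open_covers X) (open_omega_covers X)"
    and cov: "\<And>n. covers X (\<U> n)"
  obtains \<H> :: "nat \<Rightarrow> 'a set set" where "\<And>n. finite (\<H> n)" "\<And>n. \<H> n \<subseteq> \<U> n"
    "\<And>x. x \<in> topspace X \<Longrightarrow> \<exists>m. \<forall>n\<ge>m. x \<in> \<Union>(\<H> n)"
proof -
  have "\<exists>\<G>. has_finite_subcover X (\<U> n) \<longrightarrow> finite \<G> \<and> \<G> \<subseteq> \<U> n \<and> \<Union>\<G> = topspace X" for n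
    unfolding has_finite_subcover_def by blast
  then obtain \<G> where G: "\<And>n. has_finite_subcover X (\<U> n) \<Longrightarrow>
      finite (\<G> n) \<and> \<G> n \<subseteq> \<U> n \<and> \<Union>(\<G> n) = topspace X" by metis
  show thesis
  proof (cases "\<forall>n. has_finite_subcover X (\<U> n)")
    case True
    then show thesis using G by (intro that[of \<G>]) auto
  next
    case False
    then obtain p where p: "\<not> has_finite_subcover X (\<U> p)" by blast
    define \<V> where "\<V> n = (if has_finite_subcover X (\<U> n) then \<U> p else \<U> n)" for n
    have "covers X (\<V> n)" "\<not> has_finite_subcover X (\<V> n)" for n
      using cov p by (auto simp: \<V>_def)
    from hurewicz_selection_no_subcover[where \<U> = \<V>, OF cr pyt ufin this]
    obtain \<K> where K: "\<And>n. finite (\<K> n)" "\<And>n. \<K> n \<subseteq> \<V> n"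
      "\<And>x. x \<in> topspace X \<Longrightarrow> \<exists>m. \<forall>n\<ge>m. x \<in> \<Union>(\<K> n)" by metis
    show thesis
    proof (rule that)
      let ?H = "\<lambda>n. if has_finite_subcover X (\<U> n) then \<G> n else \<K> n"
      show "finite (?H n)" for n using G K(1) by auto
      show "?H n \<subseteq> \<U> n" for n using G K(2)[of n] by (auto simp: \<V>_def)
      fix x assume x: "x \<in> topspace X"
      then obtain m where "\<forall>n\<ge>m. x \<in> \<Union>(\<K> n)" using K(3) by blast
      then have "\<forall>n\<ge>m. x \<in> \<Union>(?H n)" using G x by (metis (full_types))
      then show "\<exists>m. \<forall>n\<ge>m. x \<in> \<Union>(?H n)" by blast
    qed
  qed
qed

text \<open>Beyond the Hurewicz selection, infinitely many distinct unions are needed. Otherwise one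
  union would recur infinitely often, and a point outside it would be missed infinitely
  often.\<close>

lemma Ufin_gamma:
  assumes cr: "completely_regular_space X" and pyt: "Cp_pytkeev X"
    and ufin: "Ufin X (open_covers X) (open_omega_covers X)"
  shows "Ufin X (open_covers X) (open_gamma_covers X)"
  unfolding Ufin_def
proof (intro allI impI)
  fix \<U> :: "nat \<Rightarrow> 'a set set"
  assume U: "\<forall>n. \<U> n \<in> open_covers X \<and> \<not> has_finite_subcover X (\<U> n)"
  then have cov: "covers X (\<U> n)" for n by (simp add: open_covers_iff)
  from hurewicz_selection[where \<U> = \<U>, OF cr pyt ufin this]
  obtain \<H> where H: "\<And>n. finite (\<H> n)" "\<And>n. \<H> n \<subseteq> \<U> n"
    "\<And>x. x \<in> topspace X \<Longrightarrow> \<exists>m. \<forall>n\<ge>m. x \<in> \<Union>(\<H> n)" by metis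
  have opn: "openin X (\<Union>(\<H> n))" for n
    using H(2)[of n] cov[of n] by (intro openin_Union) (auto simp: covers_def)
  have ne: "\<Union>(\<H> n) \<noteq> topspace X" for n
    using spec[OF U, of n] H(1,2)[of n] unfolding has_finite_subcover_def by blast
  have fin: "finite {n. x \<notin> \<Union>(\<H> n)}" if x: "x \<in> topspace X" for x
  proof -
    obtain m where "\<forall>n\<ge>m. x \<in> \<Union>(\<H> n)" using H(3)[OF x] by blast
    then have "{n. x \<notin> \<Union>(\<H> n)} \<subseteq> {..<m}" using not_less by blast
    then show ?thesis using finite_subset by blast
  qed
  let ?R = "range (\<lambda>n. \<Union>(\<H> n))"
  have "infinite ?R"
  proof
    assume "finite ?R"
    then obtain m where m: "infinite {n. \<Union>(\<H> n) = \<Union>(\<H> m)}"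
      using pigeonhole_infinite[of "UNIV::nat set" "\<lambda>n. \<Union>(\<H> n)"] by auto
    obtain x where "x \<in> topspace X" "x \<notin> \<Union>(\<H> m)"
      using ne[of m] openin_subset[OF opn] by blast
    moreover from this have "{n. \<Union>(\<H> n) = \<Union>(\<H> m)} \<subseteq> {n. x \<notin> \<Union>(\<H> n)}" by blast
    ultimately show False using fin m finite_subset by blast
  qed
  moreover have "finite {Y \<in> ?R. x \<notin> Y}" if "x \<in> topspace X" for x
    by (rule finite_subset[OF _ finite_imageI[OF fin[OF that], of "\<lambda>n. \<Union>(\<H> n)"]]) blast
  moreover have "topspace X = \<Union>?R"
  proof
    show "topspace X \<subseteq> \<Union>?R" using H(3) by blast
    show "\<Union>?R \<subseteq> topspace X" using openin_subset[OF opn] by blast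
  qed
  moreover have "topspace X \<notin> ?R" using ne by (metis imageE)
  ultimately have "?R \<in> open_gamma_covers X"
    unfolding open_gamma_covers_def is_gamma_cover_def is_cover_def using opn by blast
  then show "\<exists>\<F>. (\<forall>n. finite (\<F> n) \<and> \<F> n \<subseteq> \<U> n) \<and> range (\<lambda>n. \<Union>(\<F> n)) \<in> open_gamma_covers X"
    using H(1,2) by blast
qed

section \<open>The Rothberger property\<close>

text \<open>Block \<open>n\<close> has \<open>n\<close> elements and starts at
  \<open>n\<^sup>2\<close>, so both room and starting index grow. It ends before
  \<open>(n + 1)\<^sup>2\<close>, which keeps the blocks disjoint.\<close>

definition square_block :: "nat \<Rightarrow> nat set"
  where "square_block n = {n\<^sup>2..<n\<^sup>2 + n}"

lemma square_block_disjoint: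
  assumes "i \<in> square_block m" "i \<in> square_block n"
  shows "m = n"
proof -
  have *: False if "i \<in> square_block a" "i \<in> square_block b" "a < b" for a b
  proof -
    have "(Suc a)\<^sup>2 \<le> b\<^sup>2" using that by (intro power_mono) auto
    then show False using that by (auto simp: square_block_def power2_eq_square)
  qed
  show ?thesis using * assms by (meson linorder_neqE_nat)
qed

text \<open>Indices outside \<open>I\<close> receive an arbitrary member of their cover. Such a
  member exists because the space is nonempty.\<close>

lemma open_cover_selection:
  fixes \<U> :: "nat \<Rightarrow> 'a set set"
  assumes cov: "\<And>n. \<U> n \<in> open_covers X" and ne: "topspace X \<noteq> {}"
    and sel: "\<And>i. i \<in> I \<Longrightarrow> u i \<in> \<U> i" and un: "topspace X \<subseteq> (\<Union>i\<in>I. u i)"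
  shows "\<exists>U. (\<forall>n. U n \<in> \<U> n) \<and> range U \<in> open_covers X"
proof -
  have "\<exists>V. V \<in> \<U> n" for n using cov[of n] ne by (auto simp: open_covers_def is_cover_def)
  then obtain v where v: "\<And>n. v n \<in> \<U> n" by metis
  define U where "U i = (if i \<in> I then u i else v i)" for i
  have U: "U n \<in> \<U> n" for n using sel v by (simp add: U_def)
  have "openin X (U n)" "U n \<noteq> topspace X" for n
    using U[of n] cov[of n] by (auto simp: open_covers_def is_cover_def)
  moreover have "topspace X \<subseteq> \<Union>(range U)" using un by (force simp: U_def)
  ultimately have "range U \<in> open_covers X"
    unfolding open_covers_def is_cover_def using openin_subset by blast
  then show ?thesis using U by blast
qed

lemma S1_open_covers:
  assumes cr: "completely_regular_space X" and pyt: "Cp_pytkeev X"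
    and ufin: "Ufin X (open_covers X) (open_omega_covers X)" and ne: "topspace X \<noteq> {}"
  shows "S1 (open_covers X) (open_covers X)"
  unfolding S1_def
proof (intro allI impI)
  fix \<U> :: "nat \<Rightarrow> 'a set set"
  assume "\<forall>n. \<U> n \<in> open_covers X"
  then have U: "\<And>n. \<U> n \<in> open_covers X" by blast
  define \<V> where "\<V> n = {V. openin X V \<and> (\<exists>W g. W \<in> \<U> n \<and> separates X V W g)}" for n
  have "covers X (\<V> n)" for n
    unfolding covers_def
  proof (intro conjI equalityI subsetI ballI)
    show "openin X V" if "V \<in> \<V> n" for V using that by (simp add: \<V>_def)
    show "x \<in> topspace X" if "x \<in> \<Union>(\<V> n)" for x
      using that openin_subset unfolding \<V>_def by blast
    fix x assume "x \<in> topspace X"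
    then obtain W where W: "W \<in> \<U> n" "x \<in> W" "openin X W"
      using U[of n] by (auto simp: open_covers_def is_cover_def)
    then obtain V g where "openin X V" "x \<in> V" "separates X V W g"
      using completely_regular_separates[OF cr] by metis
    then show "x \<in> \<Union>(\<V> n)" using W unfolding \<V>_def by blast
  qed
  from hurewicz_selection[where \<U> = \<V>, OF cr pyt ufin this]
  obtain \<F> where F: "\<And>n. finite (\<F> n)" "\<And>n. \<F> n \<subseteq> \<V> n"
    "\<And>x. x \<in> topspace X \<Longrightarrow> \<exists>m. \<forall>n\<ge>m. x \<in> \<Union>(\<F> n)" by metis
  define W where "W n V = (SOME W. W \<in> \<U> n \<and> (\<exists>g. separates X V W g))" for n V
  define g where "g n V = (SOME g. separates X V (W n V) g)" for n V
  have W: "W n V \<in> \<U> n \<and> (\<exists>g. separates X V (W n V) g)" if "V \<in> \<F> n" for n V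
  proof -
    have "\<exists>W. W \<in> \<U> n \<and> (\<exists>g. separates X V W g)"
      using F(2)[of n] that unfolding \<V>_def by blast
    then show ?thesis unfolding W_def by (rule someI_ex)
  qed
  have g: "separates X V (W n V) (g n V)" if "V \<in> \<F> n" for n V
    unfolding g_def using conjunct2[OF W[OF that]] by (rule someI_ex)
  \<comment> \<open>An index is a block together with one member of \<open>\<F> i\<close> for each
    \<open>i\<close> in it.\<close>
  define I where "I = (SIGMA n:UNIV. Pi\<^sub>E (square_block n) \<F>)"
  define h where "h p x = (\<Prod>i\<in>square_block (fst p). g i (snd p i) x)" for p x
  have sep: "separates X (\<Union>i\<in>square_block (fst p). snd p i)
      (\<Union>i\<in>square_block (fst p). W i (snd p i)) (h p)" if "p \<in> I" for p
    unfolding h_def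
  proof (rule separates_prod)
    show "finite (square_block (fst p))" by (simp add: square_block_def)
    show "separates X (snd p i) (W i (snd p i)) (g i (snd p i))" if "i \<in> square_block (fst p)" for i
      using \<open>p \<in> I\<close> that by (intro g) (auto simp: I_def)
  qed
  have selW: "W i (snd p i) \<in> \<U> i" if "p \<in> I" "i \<in> square_block (fst p)" for p i
    using that by (intro conjunct1[OF W]) (auto simp: I_def)
  show "\<exists>U. (\<forall>n. U n \<in> \<U> n) \<and> range U \<in> open_covers X"
  \<comment> \<open>If some \<open>h p\<close> is identically zero, the choices in its single block
    already cover the space. Otherwise the Pytkeev property applies.\<close>
  proof (cases "\<exists>p\<in>I. \<forall>x\<in>topspace X. h p x = 0")
    case True
    then obtain p where p: "p \<in> I" "\<forall>x\<in>topspace X. h p x = 0" by blast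
    then have "topspace X \<subseteq> (\<Union>i\<in>square_block (fst p). W i (snd p i))"
      using separates_in[OF sep] by fastforce
    then show ?thesis
      by (rule open_cover_selection[where u = "\<lambda>i. W i (snd p i)", OF U ne selW[OF p(1)], rotated])
  next
    case False
    then have nz: "\<exists>x\<in>topspace X. h p x \<noteq> 0" if "p \<in> I" for p using that by blast
    have cont: "continuous_map X euclideanreal (h p)" if "p \<in> I" for p
      using sep[OF that] by (simp add: separates_def)
    have small: "\<exists>p\<in>I. \<forall>x\<in>E. h p x = 0" if E: "finite E" "E \<subseteq> topspace X" for E
    proof -
      \<comment> \<open>The extra point \<open>x0\<close> is the default target for block positions
        not assigned to a point of \<open>E\<close>.\<close>
      obtain x0 where x0: "x0 \<in> topspace X" using ne by blast
      define D where "D = insert x0 E"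
      have D: "finite D" "D \<subseteq> topspace X" "D \<noteq> {}" using E x0 by (auto simp: D_def)
      have "\<exists>m. x \<in> topspace X \<longrightarrow> (\<forall>n\<ge>m. x \<in> \<Union>(\<F> n))" for x using F(3) by blast
      then obtain t where t: "\<And>x n. x \<in> topspace X \<Longrightarrow> n \<ge> t x \<Longrightarrow> x \<in> \<Union>(\<F> n)" by metis
      \<comment> \<open>The first summand makes room for an injection of \<open>D\<close> into the
        block. The second makes every index in the block at least \<open>t x\<close> for each
        \<open>x\<close> in \<open>D\<close>.\<close>
      define n where "n = card D + (\<Sum>x\<in>D. t x)"
      have tn: "t x \<le> i" if "x \<in> D" "i \<in> square_block n" for x i
      proof -
        have "t x \<le> (\<Sum>x\<in>D. t x)" using D(1) that(1) by (intro member_le_sum) auto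
        also have "\<dots> \<le> n" by (simp add: n_def)
        also have "\<dots> \<le> n\<^sup>2" by (simp add: power2_eq_square)
        finally show ?thesis using that by (simp add: square_block_def)
      qed
      have "card D \<le> card (square_block n)" by (simp add: square_block_def n_def)
      then obtain e where e: "e ` D \<subseteq> square_block n" "inj_on e D"
        using card_le_inj[OF D(1), of "square_block n"] by (auto simp: square_block_def)
      define pt where "pt i = (if i \<in> e ` D then inv_into D e i else x0)" for i
      have pt: "pt i \<in> D" for i by (auto simp: pt_def inv_into_into) (simp add: D_def)
      have "\<forall>i\<in>square_block n. \<exists>V. V \<in> \<F> i \<and> pt i \<in> V"
      proof
        fix i assume "i \<in> square_block n"
        then have "pt i \<in> \<Union>(\<F> i)"
          by (rule t[OF subsetD[OF D(2) pt] tn[OF pt]])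
        then show "\<exists>V. V \<in> \<F> i \<and> pt i \<in> V" by blast
      qed
      from bchoice[OF this] obtain v
        where v: "\<And>i. i \<in> square_block n \<Longrightarrow> v i \<in> \<F> i \<and> pt i \<in> v i" by blast
      let ?p = "(n, restrict v (square_block n))"
      have "?p \<in> I" using v by (auto simp: I_def)
      moreover have "h ?p x = 0" if "x \<in> E" for x
      proof -
        have "x \<in> D" using that by (simp add: D_def)
        then have "e x \<in> square_block n" "pt (e x) = x" using e by (auto simp: pt_def)
        then have "x \<in> (\<Union>i\<in>square_block (fst ?p). snd ?p i)" using v by force
        then show ?thesis using sep[OF \<open>?p \<in> I\<close>] unfolding separates_def by blast
      qed
      ultimately show ?thesis by blast
    qed
    obtain J where J: "\<And>k. infinite (J k)" "\<And>k. J k \<subseteq> I"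
      "\<And>x. x \<in> topspace X \<Longrightarrow> \<exists>k::nat. \<forall>p\<in>J k. \<bar>h p x\<bar> < 1"
      using pytkeev_family[where h = h and I = I, OF pyt cont nz small] by metis
    \<comment> \<open>Blocks up to \<open>N\<close> admit only finitely many choices altogether, so
      they cannot exhaust the infinite set \<open>J k\<close>.\<close>
    have large: "\<exists>p\<in>J k. N < fst p" for k N
    proof (rule ccontr)
      assume "\<not> ?thesis"
      then have "J k \<subseteq> (SIGMA n:{..N}. Pi\<^sub>E (square_block n) \<F>)"
        using J(2)[of k] by (fastforce simp: I_def)
      moreover have "finite (SIGMA n:{..N}. Pi\<^sub>E (square_block n) \<F>)"
        using F(1) by (intro finite_SigmaI finite_PiE) (auto simp: square_block_def)
      ultimately show False using J(1) finite_subset by blast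
    qed
    \<comment> \<open>One choice from each \<open>J k\<close> suffices, since a point good for
      \<open>J k\<close> is good for \<open>q k\<close>. Increasing block numbers make the blocks
      disjoint, so the choices never compete for an index.\<close>
    have "\<exists>q. \<forall>k. q k \<in> J k \<and> fst (q k) < fst (q (Suc k))"
      by (rule dependent_nat_choice) (use large in blast)+
    then obtain q where q: "\<And>k. q k \<in> J k" "\<And>k. fst (q k) < fst (q (Suc k))" by blast
    have "strict_mono (\<lambda>k. fst (q k))" using q(2) by (simp add: strict_mono_Suc_iff)
    then have inj: "k = l" if "fst (q k) = fst (q l)" for k l
      using that strict_mono_eq by blast
    have qI: "q k \<in> I" for k using q(1) J(2) by blast
    \<comment> \<open>Disjointness lets an index recover the unique \<open>k\<close> whose choice
      applies to it.\<close>
    define \<kappa> where "\<kappa> i = (THE k. i \<in> square_block (fst (q k)))" for i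
    have \<kappa>: "\<kappa> i = k" if "i \<in> square_block (fst (q k))" for i k
      unfolding \<kappa>_def using that square_block_disjoint inj by (intro the_equality) blast+
    show ?thesis
    proof (rule open_cover_selection[OF U ne])
      let ?I = "\<Union>k. square_block (fst (q k))"
      let ?u = "\<lambda>i. W i (snd (q (\<kappa> i)) i)"
      show "?u i \<in> \<U> i" if "i \<in> ?I" for i using that \<kappa> selW[OF qI] by auto
      show "topspace X \<subseteq> (\<Union>i\<in>?I. ?u i)"
      proof
        fix x assume x: "x \<in> topspace X"
        then obtain k where "\<forall>p\<in>J k. \<bar>h p x\<bar> < 1" using J(3) by blast
        then have "x \<in> (\<Union>i\<in>square_block (fst (q k)). W i (snd (q k) i))"
          using separates_in[OF sep[OF qI] x] q(1) by blast
        then show "x \<in> (\<Union>i\<in>?I. ?u i)" using \<kappa> by fastforce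
      qed
    qed
  qed
qed

theorem theorem11:
  fixes X :: "'a topology"
  assumes "tychonoff_space X"
    and "topspace X \<noteq> {}"
    and "Cp_pytkeev X"
    and "Ufin X (open_covers X) (open_omega_covers X)"
  shows "Ufin X (open_covers X) (open_gamma_covers X) \<and> S1 (open_covers X) (open_covers X)"
  using assms Ufin_gamma S1_open_covers unfolding tychonoff_space_def by blast

end
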